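(* Let $L$ be a decomposable lattice. The following conditions are equivalent: (1) $Spe(L)=MinSpe(L)$, i.e. every prime ideal of $L$ is a minimal prime ideal. (2) $L=(a]\vee a^{\perp}$ for every $a\in L$. (3) $L$ is projectable, i.e. $L=x^{\perp}\vee x^{\perp\perp}$ for every $x\in L$, and $(x]=x^{\perp\perp}$ for every $x\in L$.
   Context: A decomposable lattice is a distributive lattice $L$ with minimum element $0$ such that for any $a,b\in L$ that are not comparable there exist $\overline{a},\overline{b}\in L$ with $a=\overline{a}\vee(a\wedge b)$, $b=\overline{b}\vee(a\wedge b)$ and $\overline{a}\wedge\overline{b}=0$. An ideal of $L$ is a nonempty subset closed under $\vee$ and downward closed; $(a]=\{x\in L\mid x\leq a\}$; for ideals $I,J$, $I\vee J=\{a\vee b\mid a\in I,\ b\in J\}$. An ideal $P$ is prime if $P\neq L$ and $a\wedge b\in P$ implies $a\in P$ or $b\in P$. $Spe(L)$ is the set of prime ideals and $MinSpe(L)$ the set of prime ideals that are minimal under inclusion among prime ideals. For $\emptyset\neq A\subseteq L$, $A^{\perp}=\{x\in L\mid x\wedge a=0\text{ for all }a\in A\}$, $a^{\perp}=\{a\}^{\perp}$, $a^{\perp\perp}=(a^{\perp})^{\perp}$. *)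

theory Defs
  imports Main
begin

class decomposable_lattice = distrib_lattice + bounded_lattice_bot +
  assumes decomposable:
    "\<not> a \<le> b \<Longrightarrow> \<not> b \<le> a \<Longrightarrow>
      \<exists>a' b'. a = sup a' (inf a b) \<and> b = sup b' (inf a b) \<and> inf a' b' = bot"

definition lattice_ideal :: "'a::lattice set \<Rightarrow> bool" where
  "lattice_ideal I \<longleftrightarrow>
     I \<noteq> {} \<and> (\<forall>a\<in>I. \<forall>b\<in>I. sup a b \<in> I) \<and> (\<forall>a\<in>I. \<forall>x. x \<le> a \<longrightarrow> x \<in> I)"

definition ideal_join :: "'a::lattice set \<Rightarrow> 'a set \<Rightarrow> 'a set" where
  "ideal_join I J = {sup a b | a b. a \<in> I \<and> b \<in> J}"

definition prime_lattice_ideal :: "'a::lattice set \<Rightarrow> bool" where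
  "prime_lattice_ideal P \<longleftrightarrow>
     lattice_ideal P \<and> P \<noteq> UNIV \<and> (\<forall>a b. inf a b \<in> P \<longrightarrow> a \<in> P \<or> b \<in> P)"

definition Spe :: "'a::lattice set set" where
  "Spe = {P. prime_lattice_ideal P}"

definition MinSpe :: "'a::lattice set set" where
  "MinSpe = {P \<in> Spe. \<forall>Q\<in>Spe. Q \<subseteq> P \<longrightarrow> Q = P}"

definition perp :: "'a::bounded_lattice_bot set \<Rightarrow> 'a set" where
  "perp A = {x. \<forall>a\<in>A. inf x a = bot}"

text \<open>The lattice is the whole type, so the type argument serves as the name of the lattice.\<close>

definition projectable :: "'a::bounded_lattice_bot itself \<Rightarrow> bool" where
  "projectable L \<longleftrightarrow> (\<forall>x::'a. UNIV = ideal_join (perp {x}) (perp (perp {x})))"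

end

theory Submission
  imports Defs
begin

text \<open>The equivalence of (1) and (2) turns on whether prime ideals can see the annihilator of an
  element. If \<open>L = (a] \<or> a\<^sup>\<perp>\<close> for all \<open>a\<close> and \<open>Q \<subseteq> P\<close> are primes with some \<open>a \<in> P - Q\<close>, then
  primeness puts \<open>a\<^sup>\<perp>\<close> inside \<open>Q\<close>, so \<open>P\<close> swallows both \<open>(a]\<close> and \<open>a\<^sup>\<perp>\<close> and cannot be proper.
  Conversely, if \<open>(a] \<or> a\<^sup>\<perp>\<close> is a proper ideal, it lies in a prime ideal, which contains \<open>a\<close> together
  with everything disjoint from \<open>a\<close>; a minimal prime never does this
  (\<open>minimal_prime_omits_annihilator\<close>). Both the existence of the prime and the property of minimal
  primes come from one prime ideal theorem (\<open>prime_ideal_separation\<close>), proved by Zorn's lemma and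
  distributivity.

  The equivalence of (2) and (3) is elementary: splitting \<open>y \<in> a\<^sup>\<perp>\<^sup>\<perp>\<close> along \<open>(a] \<or> a\<^sup>\<perp>\<close> leaves a
  part in \<open>a\<^sup>\<perp> \<inter> a\<^sup>\<perp>\<^sup>\<perp> = {0}\<close>, so \<open>y \<le> a\<close>. Thus (2) already identifies \<open>a\<^sup>\<perp>\<^sup>\<perp>\<close> with \<open>(a]\<close>, and under
  this identification the two decompositions of \<open>L\<close> are the same.\<close>

section \<open>Ideals and annihilators\<close>

lemma lattice_ideal_supI: "lattice_ideal I \<Longrightarrow> a \<in> I \<Longrightarrow> b \<in> I \<Longrightarrow> sup a b \<in> I"
  by (auto simp: lattice_ideal_def)

lemma lattice_ideal_downI: "lattice_ideal I \<Longrightarrow> a \<in> I \<Longrightarrow> x \<le> a \<Longrightarrow> x \<in> I"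
  by (auto simp: lattice_ideal_def)

lemma bot_mem_lattice_ideal:
  fixes I :: "'a::bounded_lattice_bot set"
  shows "lattice_ideal I \<Longrightarrow> bot \<in> I"
  by (auto simp: lattice_ideal_def)

lemma lattice_ideal_atMost: "lattice_ideal {..a}"
  by (auto simp: lattice_ideal_def intro: order_trans)

lemma ideal_join_commute: "ideal_join I J = ideal_join J I"
  unfolding ideal_join_def by (metis sup_commute)

lemma ideal_join_subset_ideal:
  "lattice_ideal K \<Longrightarrow> I \<subseteq> K \<Longrightarrow> J \<subseteq> K \<Longrightarrow> ideal_join I J \<subseteq> K"
  unfolding ideal_join_def by (auto intro!: lattice_ideal_supI)

lemma subset_ideal_join:
  assumes I: "lattice_ideal I" and J: "lattice_ideal J"
  shows "I \<subseteq> ideal_join I J"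
proof
  fix x assume x: "x \<in> I"
  obtain y where y: "y \<in> J" using J by (auto simp: lattice_ideal_def)
  have "inf x y \<in> J" using lattice_ideal_downI[OF J y] by simp
  moreover have "x = sup x (inf x y)" by simp
  ultimately show "x \<in> ideal_join I J" using x unfolding ideal_join_def by blast
qed

text \<open>Distributivity gives closure downwards: an element below \<open>sup a b\<close> is the join of its meets
  with \<open>a\<close> and \<open>b\<close>.\<close>

lemma lattice_ideal_ideal_join:
  fixes I J :: "'a::distrib_lattice set"
  assumes I: "lattice_ideal I" and J: "lattice_ideal J"
  shows "lattice_ideal (ideal_join I J)"
  unfolding lattice_ideal_def
proof (intro conjI ballI allI impI)
  show "ideal_join I J \<noteq> {}"
    using subset_ideal_join[OF I J] I by (auto simp: lattice_ideal_def)
next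
  fix x y assume "x \<in> ideal_join I J" "y \<in> ideal_join I J"
  then obtain a b c d where *: "x = sup a b" "y = sup c d" "a \<in> I" "b \<in> J" "c \<in> I" "d \<in> J"
    by (auto simp: ideal_join_def)
  have "sup x y = sup (sup a c) (sup b d)" by (simp add: * ac_simps)
  then show "sup x y \<in> ideal_join I J"
    using * lattice_ideal_supI[OF I] lattice_ideal_supI[OF J] unfolding ideal_join_def by blast
next
  fix x y assume "x \<in> ideal_join I J" "y \<le> x"
  then obtain a b where *: "y \<le> sup a b" "a \<in> I" "b \<in> J"
    by (auto simp: ideal_join_def)
  have "y = sup (inf y a) (inf y b)"
    using *(1) by (simp add: inf_absorb1 flip: inf_sup_distrib1)
  moreover have "inf y a \<in> I" "inf y b \<in> J"
    using * lattice_ideal_downI[OF I] lattice_ideal_downI[OF J] by auto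
  ultimately show "y \<in> ideal_join I J" unfolding ideal_join_def by blast
qed

lemma lattice_ideal_perp:
  fixes A :: "'a::{distrib_lattice,bounded_lattice_bot} set"
  shows "lattice_ideal (perp A)"
  unfolding lattice_ideal_def
proof (intro conjI ballI allI impI)
  show "perp A \<noteq> {}" by (auto simp: perp_def intro: exI[of _ bot])
next
  fix x y assume "x \<in> perp A" "y \<in> perp A"
  then show "sup x y \<in> perp A" by (simp add: perp_def inf_sup_distrib2)
next
  fix x y assume x: "x \<in> perp A" and y: "y \<le> x"
  have "inf y a = bot" if "a \<in> A" for a
    using x that inf_mono[OF y order_refl, of a] by (simp add: perp_def bot_unique)
  then show "y \<in> perp A" by (simp add: perp_def)
qed

lemma subset_perp_perp: "A \<subseteq> perp (perp A)"
  by (auto simp: perp_def inf_commute)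

lemma perp_Int_perp_perp: "x \<in> perp A \<Longrightarrow> x \<in> perp (perp A) \<Longrightarrow> x = bot"
  unfolding perp_def by force

section \<open>Prime ideals\<close>

text \<open>An ideal that is maximal among those avoiding a meet-closed set \<open>S\<close> is prime: if neither \<open>a\<close>
  nor \<open>b\<close> belongs to it, then adjoining either one makes it meet \<open>S\<close>, and by distributivity the meet
  of the two witnesses lies below an element of the ideal joined with \<open>inf a b\<close>.
  Stating this for a meet-closed set instead of a filter lets a singleton, or the meets of a fixed
  element with the complement of a prime ideal, serve directly as \<open>S\<close>.\<close>

lemma prime_ideal_separation:
  fixes I S :: "'a::distrib_lattice set"
  assumes I: "lattice_ideal I" and ne: "S \<noteq> {}"
    and S: "\<And>s t. s \<in> S \<Longrightarrow> t \<in> S \<Longrightarrow> inf s t \<in> S" and disj: "I \<inter> S = {}"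
  obtains P where "prime_lattice_ideal P" "I \<subseteq> P" "P \<inter> S = {}"
proof -
  define F where "F = {J. lattice_ideal J \<and> I \<subseteq> J \<and> J \<inter> S = {}}"
  have "I \<in> F" using I disj by (simp add: F_def)
  have "\<exists>P\<in>F. \<forall>J\<in>F. P \<subseteq> J \<longrightarrow> J = P"
  proof (rule subset_Zorn_nonempty)
    show "F \<noteq> {}" using \<open>I \<in> F\<close> by blast
  next
    fix C assume C: "C \<noteq> {}" "subset.chain F C"
    then have CF: "\<And>J. J \<in> C \<Longrightarrow> lattice_ideal J \<and> I \<subseteq> J \<and> J \<inter> S = {}"
      by (auto simp: subset.chain_def F_def)
    have "lattice_ideal (\<Union>C)"
      unfolding lattice_ideal_def
    proof (intro conjI ballI allI impI)
      show "\<Union>C \<noteq> {}" using C(1) CF by (fastforce simp: lattice_ideal_def)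
    next
      fix x y assume "x \<in> \<Union>C" "y \<in> \<Union>C"
      then obtain J K where JK: "x \<in> J" "J \<in> C" "y \<in> K" "K \<in> C" by blast
      then have "J \<subseteq> K \<or> K \<subseteq> J" using C(2) by (auto simp: subset_chain_def)
      then show "sup x y \<in> \<Union>C" using JK CF lattice_ideal_supI by blast
    next
      fix x y assume "x \<in> \<Union>C" "y \<le> x"
      then show "y \<in> \<Union>C" using CF lattice_ideal_downI by blast
    qed
    then show "\<Union>C \<in> F" using C(1) CF by (auto simp: F_def)
  qed
  then obtain P where P: "lattice_ideal P" "I \<subseteq> P" "P \<inter> S = {}"
    and max: "\<And>J. J \<in> F \<Longrightarrow> P \<subseteq> J \<Longrightarrow> J = P"
    by (auto simp: F_def)
  have meets: "\<exists>s\<in>S. \<exists>p\<in>P. s \<le> sup p a" if "a \<notin> P" for a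
  proof -
    have *: "lattice_ideal (ideal_join P {..a})" "P \<subseteq> ideal_join P {..a}"
      "{..a} \<subseteq> ideal_join P {..a}"
      using P(1) lattice_ideal_atMost[of a] lattice_ideal_ideal_join subset_ideal_join
        ideal_join_commute by metis+
    then have "ideal_join P {..a} \<notin> F" using max that by blast
    then obtain s where "s \<in> S" "s \<in> ideal_join P {..a}" using * P by (auto simp: F_def)
    then show ?thesis unfolding ideal_join_def by (auto intro: sup_mono)
  qed
  have "a \<in> P \<or> b \<in> P" if ab: "inf a b \<in> P" for a b
  proof (rule ccontr)
    assume "\<not> (a \<in> P \<or> b \<in> P)"
    then obtain s t p q where *: "s \<in> S" "t \<in> S" "p \<in> P" "q \<in> P" "s \<le> sup p a" "t \<le> sup q b"
      using meets by meson
    have "s \<le> sup (sup p q) a" "t \<le> sup (sup p q) b"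
      using *(5,6) by (meson order_refl order_trans sup_ge1 sup_ge2 sup_mono)+
    then have "inf s t \<le> sup (sup p q) (inf a b)"
      by (simp add: sup_inf_distrib1 le_infI1 le_infI2)
    moreover have "sup (sup p q) (inf a b) \<in> P"
      using * ab lattice_ideal_supI[OF P(1)] by simp
    ultimately have "inf s t \<in> P" using lattice_ideal_downI[OF P(1)] by blast
    then show False using S * P(3) by blast
  qed
  moreover have "P \<noteq> UNIV" using P(3) ne by blast
  ultimately have "prime_lattice_ideal P" using P(1) by (simp add: prime_lattice_ideal_def)
  then show thesis using that P by blast
qed

text \<open>If an element \<open>a\<close> of the prime ideal \<open>P\<close> is disjoint from no element outside \<open>P\<close>, then the
  meets of \<open>a\<close> with the complement of \<open>P\<close> avoid \<open>bot\<close>, and a prime ideal avoiding these meets is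
  contained in \<open>P\<close> and omits \<open>a\<close>, against minimality.\<close>

lemma minimal_prime_omits_annihilator:
  fixes P :: "'a::{distrib_lattice,bounded_lattice_bot} set"
  assumes P: "P \<in> MinSpe" and a: "a \<in> P"
  shows "\<not> perp {a} \<subseteq> P"
proof
  assume sub: "perp {a} \<subseteq> P"
  have prime: "lattice_ideal P" "P \<noteq> UNIV" "\<And>x y. inf x y \<in> P \<Longrightarrow> x \<in> P \<or> y \<in> P"
    and min: "\<And>Q. prime_lattice_ideal Q \<Longrightarrow> Q \<subseteq> P \<Longrightarrow> Q = P"
    using P by (auto simp: MinSpe_def Spe_def prime_lattice_ideal_def)
  define S where "S = {inf u a | u. u \<notin> P}"
  obtain Q where Q: "prime_lattice_ideal Q" "{..bot} \<subseteq> Q" "Q \<inter> S = {}"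
  proof (rule prime_ideal_separation)
    show "lattice_ideal {..bot :: 'a}" by (rule lattice_ideal_atMost)
    show "S \<noteq> {}" using prime(2) by (auto simp: S_def)
    show "{..bot} \<inter> S = {}" using sub by (auto simp: S_def perp_def bot_unique)
  next
    fix s t assume "s \<in> S" "t \<in> S"
    then obtain u v where uv: "s = inf u a" "t = inf v a" "u \<notin> P" "v \<notin> P"
      by (auto simp: S_def)
    have "inf s t = inf (inf u v) a" by (simp add: uv ac_simps)
    moreover have "inf u v \<notin> P" using uv prime(3) by blast
    ultimately show "inf s t \<in> S" by (auto simp: S_def)
  qed
  have Qdown: "\<And>x y. x \<in> Q \<Longrightarrow> y \<le> x \<Longrightarrow> y \<in> Q"
    using Q(1) by (auto simp: prime_lattice_ideal_def intro: lattice_ideal_downI)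
  have "Q \<subseteq> P"
  proof
    fix u assume "u \<in> Q"
    then have "inf u a \<in> Q" using Qdown by simp
    then show "u \<in> P" using Q(3) by (auto simp: S_def)
  qed
  then have "a \<in> Q" using min Q(1) a by blast
  then have "inf u a \<in> Q" for u using Qdown by simp
  then show False using Q(3) prime(2) by (auto simp: S_def)
qed

section \<open>The equivalences\<close>

lemma all_primes_minimal_iff:
  "(Spe :: 'a::{distrib_lattice,bounded_lattice_bot} set set) = MinSpe
     \<longleftrightarrow> (\<forall>a::'a. UNIV = ideal_join {..a} (perp {a}))"
proof
  assume eq: "(Spe :: 'a set set) = MinSpe"
  show "\<forall>a::'a. UNIV = ideal_join {..a} (perp {a})"
  proof (rule allI, rule ccontr)
    fix a :: 'a
    let ?I = "ideal_join {..a} (perp {a})"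
    assume "UNIV \<noteq> ?I"
    then obtain c where c: "c \<notin> ?I" by blast
    have I: "lattice_ideal ?I" "{..a} \<subseteq> ?I" "perp {a} \<subseteq> ?I"
      using lattice_ideal_atMost[of a] lattice_ideal_perp[of "{a}"]
        lattice_ideal_ideal_join subset_ideal_join ideal_join_commute by metis+
    obtain P where P: "prime_lattice_ideal P" "?I \<subseteq> P"
      by (rule prime_ideal_separation[OF I(1), of "{c}"]) (use c in auto)
    then have "P \<in> MinSpe" using eq by (auto simp: Spe_def)
    moreover have "a \<in> P" "perp {a} \<subseteq> P" using I P(2) by auto
    ultimately show False using minimal_prime_omits_annihilator by blast
  qed
next
  assume split: "\<forall>a::'a. UNIV = ideal_join {..a} (perp {a})"
  have "Q = P" if P: "prime_lattice_ideal P" and Q: "prime_lattice_ideal Q" and QP: "Q \<subseteq> P"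
    for P Q :: "'a set"
  proof (rule ccontr)
    assume "Q \<noteq> P"
    then obtain a where a: "a \<in> P" "a \<notin> Q" using QP by blast
    have "bot \<in> Q" using Q by (simp add: prime_lattice_ideal_def bot_mem_lattice_ideal)
    then have "perp {a} \<subseteq> Q"
      using Q a(2) by (force simp: prime_lattice_ideal_def perp_def)
    moreover have "lattice_ideal P" "P \<noteq> UNIV" using P by (auto simp: prime_lattice_ideal_def)
    moreover have "{..a} \<subseteq> P" using a(1) \<open>lattice_ideal P\<close> lattice_ideal_downI by auto
    ultimately have "ideal_join {..a} (perp {a}) \<subseteq> P"
      using QP by (intro ideal_join_subset_ideal) auto
    then show False using split \<open>P \<noteq> UNIV\<close> by blast
  qed
  then show "(Spe :: 'a set set) = MinSpe" by (auto simp: MinSpe_def Spe_def)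
qed

lemma perp_perp_eq_atMost:
  fixes a :: "'a::{distrib_lattice,bounded_lattice_bot}"
  assumes split: "UNIV = ideal_join {..a} (perp {a})"
  shows "perp (perp {a}) = {..a}"
proof
  show "{..a} \<subseteq> perp (perp {a})"
    using subset_perp_perp[of "{a}"] lattice_ideal_downI[OF lattice_ideal_perp] by auto
  show "perp (perp {a}) \<subseteq> {..a}"
  proof
    fix y assume y: "y \<in> perp (perp {a})"
    obtain u v where uv: "y = sup u v" "u \<le> a" "v \<in> perp {a}"
      using split unfolding ideal_join_def by blast
    have "v \<in> perp (perp {a})" using lattice_ideal_downI[OF lattice_ideal_perp y] uv(1) by simp
    then have "v = bot" using uv(3) by (rule perp_Int_perp_perp[rotated])
    then show "y \<in> {..a}" using uv by simp
  qed
qed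

theorem theorem4p8:
  shows "((Spe :: 'a::decomposable_lattice set set) = MinSpe
            \<longleftrightarrow> (\<forall>a::'a. UNIV = ideal_join {..a} (perp {a})))
       \<and> ((\<forall>a::'a. UNIV = ideal_join {..a} (perp {a}))
            \<longleftrightarrow> projectable TYPE('a) \<and> (\<forall>x::'a. {..x} = perp (perp {x})))"
proof (intro conjI)
  show "(Spe :: 'a set set) = MinSpe \<longleftrightarrow> (\<forall>a::'a. UNIV = ideal_join {..a} (perp {a}))"
    by (rule all_primes_minimal_iff)
  show "(\<forall>a::'a. UNIV = ideal_join {..a} (perp {a}))
          \<longleftrightarrow> projectable TYPE('a) \<and> (\<forall>x::'a. {..x} = perp (perp {x}))"
  proof
    assume split: "\<forall>a::'a. UNIV = ideal_join {..a} (perp {a})"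
    then have "\<forall>x::'a. {..x} = perp (perp {x})" using perp_perp_eq_atMost by blast
    then show "projectable TYPE('a) \<and> (\<forall>x::'a. {..x} = perp (perp {x}))"
      using split ideal_join_commute unfolding projectable_def by metis
  next
    assume "projectable TYPE('a) \<and> (\<forall>x::'a. {..x} = perp (perp {x}))"
    then show "\<forall>a::'a. UNIV = ideal_join {..a} (perp {a})"
      using ideal_join_commute unfolding projectable_def by metis
  qed
qed

end
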